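(* Let $r\in\mathbb{Z}$, $h\ge 0$, and let $i_1,\dots,i_h\in\{1,2\}$ with $i_j\neq i_{j+1}$ for $1\le j<h$, and $s_1,\dots,s_h>0$ integers. Then the expression $\Delta_3^r x_{i_1}^{s_1}x_{i_2}^{s_2}\cdots x_{i_h}^{s_h}$ is in Garside normal form if and only if one of the following holds: (i) $h\le 2$; or (ii) $h\ge 3$ and all the exponents $s_j$ are $\ge 2$, with the possible exceptions of $s_1$ or $s_h$ (that is, $s_j\ge 2$ for all $1<j<h$).
   Context: $\mathcal{B}_3=\langle x_1,x_2 : x_2x_1x_2=x_1x_2x_1\rangle$ is the 3-braid group. $\mathcal{MB}_3\subset\mathcal{B}_3$ is the monoid of positive elements (products of $x_1,x_2$); by Garside it has the same presentation as a monoid. $\Delta_3=x_1x_2x_1$, and $\mathcal{MB}_3^+=\mathcal{MB}_3\setminus\Delta_3\mathcal{MB}_3$. Every element of $\mathcal{B}_3$ can be written uniquely as $\Delta_3^rW$ with $r\in\mathbb{Z}$ and $W\in\mathcal{MB}_3^+$; an expression $\Delta_3^rW$ is in (Garside) normal form when $W\in\mathcal{MB}_3^+$. *)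

theory Defs
  imports Main
begin

section \<open>The 3-braid group\<close>

datatype gen = X1 | X2

text \<open>A letter \<open>(g, True)\<close> stands for the generator \<open>g\<close> and \<open>(g, False)\<close> for its formal
  inverse.  Two words represent the same braid if they are related by the smallest congruence
  on words containing the free cancellations and the braid relation.\<close>

type_synonym letter = "gen \<times> bool"

inductive braid_eq :: "letter list \<Rightarrow> letter list \<Rightarrow> bool" where
  refl: "braid_eq u u"
| sym: "braid_eq u v \<Longrightarrow> braid_eq v u"
| trans: "braid_eq u v \<Longrightarrow> braid_eq v w \<Longrightarrow> braid_eq u w"
| append: "braid_eq u u' \<Longrightarrow> braid_eq v v' \<Longrightarrow> braid_eq (u @ v) (u' @ v')"
| cancel: "braid_eq [(g, b), (g, \<not> b)] []"
| braid: "braid_eq [(X2, True), (X1, True), (X2, True)] [(X1, True), (X2, True), (X1, True)]"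

definition inv_word :: "letter list \<Rightarrow> letter list" where
  "inv_word w = rev (map (\<lambda>(g, b). (g, \<not> b)) w)"

lemma inv_word_append: "inv_word (u @ v) = inv_word v @ inv_word u"
  by (simp add: inv_word_def)

lemma inv_word_left: "braid_eq (inv_word w @ w) []"
proof (induction w)
  case Nil
  show ?case by (simp add: inv_word_def braid_eq.refl)
next
  case (Cons a w)
  obtain g b where a: "a = (g, b)" by (cases a)
  have "braid_eq [(g, \<not> b), (g, b)] []"
    using braid_eq.cancel[of g "\<not> b"] by simp
  then have "braid_eq (inv_word w @ ([(g, \<not> b), (g, b)] @ w)) (inv_word w @ ([] @ w))"
    by (intro braid_eq.append braid_eq.refl)
  moreover have "inv_word (a # w) @ a # w = inv_word w @ ([(g, \<not> b), (g, b)] @ w)"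
    by (simp add: inv_word_def a)
  ultimately show ?case using Cons.IH braid_eq.trans by auto
qed

lemma inv_word_inv_word: "inv_word (inv_word w) = w"
  by (induction w) (auto simp: inv_word_def)

lemma inv_word_right: "braid_eq (w @ inv_word w) []"
  using inv_word_left[of "inv_word w"] by (simp add: inv_word_inv_word)

lemma inv_word_cong:
  assumes "braid_eq u v"
  shows "braid_eq (inv_word u) (inv_word v)"
proof -
  have "braid_eq (inv_word u @ (u @ inv_word v)) (inv_word u @ (v @ inv_word v))"
    by (intro braid_eq.append braid_eq.refl assms)
  moreover have "braid_eq (inv_word u @ (v @ inv_word v)) (inv_word u @ [])"
    by (intro braid_eq.append braid_eq.refl inv_word_right)
  moreover have "braid_eq ((inv_word u @ u) @ inv_word v) ([] @ inv_word v)"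
    by (intro braid_eq.append braid_eq.refl inv_word_left)
  ultimately show ?thesis
    by (metis append.assoc append_Nil append_Nil2 braid_eq.sym braid_eq.trans)
qed

quotient_type braid3 = "letter list" / braid_eq
  by (rule equivpI)
    (auto intro: reflpI sympI transpI braid_eq.refl braid_eq.sym braid_eq.trans)

instantiation braid3 :: "{monoid_mult, inverse}"
begin

lift_definition one_braid3 :: braid3 is "[]" .

lift_definition times_braid3 :: "braid3 \<Rightarrow> braid3 \<Rightarrow> braid3" is append
  by (rule braid_eq.append)

lift_definition inverse_braid3 :: "braid3 \<Rightarrow> braid3" is inv_word
  by (rule inv_word_cong)

definition divide_braid3 :: "braid3 \<Rightarrow> braid3 \<Rightarrow> braid3" where
  "divide_braid3 a b = a * inverse b"

instance
  by standard (transfer; simp add: braid_eq.refl)+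

end

interpretation braid3: group "(*)" "1 :: braid3" inverse
proof
  fix a :: braid3
  show "1 * a = a" by simp
  show "inverse a * a = 1" by transfer (rule inv_word_left)
qed

lift_definition braid_gen :: "gen \<Rightarrow> braid3" is "\<lambda>g. [(g, True)]" .

lemma braid_relation: "braid_gen X2 * braid_gen X1 * braid_gen X2 = braid_gen X1 * braid_gen X2 * braid_gen X1"
proof transfer
  show "braid_eq (([(X2, True)] @ [(X1, True)]) @ [(X2, True)])
    (([(X1, True)] @ [(X2, True)]) @ [(X1, True)])"
    using braid_eq.braid by simp
qed

section \<open>Positive braids and Garside normal form\<close>

inductive_set MB3 :: "braid3 set" where
  one: "1 \<in> MB3"
| gen_mult: "w \<in> MB3 \<Longrightarrow> braid_gen g * w \<in> MB3"

definition Delta3 :: braid3 where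
  "Delta3 = braid_gen X1 * braid_gen X2 * braid_gen X1"

definition MB3_plus :: "braid3 set" where
  "MB3_plus = MB3 - (\<lambda>w. Delta3 * w) ` MB3"

text \<open>\<open>garside_normal_form b r W\<close>: the expression \<open>Delta3 powi r * W\<close> denotes \<open>b\<close> and is in
  normal form.\<close>

definition garside_normal_form :: "braid3 \<Rightarrow> int \<Rightarrow> braid3 \<Rightarrow> bool" where
  "garside_normal_form b r W \<longleftrightarrow> b = Delta3 powi r * W \<and> W \<in> MB3_plus"

end

theory Submission
  imports Defs
begin

text \<open>If \<open>s\<^sub>j = 1\<close> for some inner \<open>j\<close>, the word contains \<open>x\<^sub>1x\<^sub>2x\<^sub>1\<close> or \<open>x\<^sub>2x\<^sub>1x\<^sub>2\<close>, i.e.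
  \<open>\<Delta>\<close>, which can be moved to the front since it commutes with the generators up to exchanging
  them.  For the converse, call a positive word reduced if it contains neither of these two
  factors, and let a pair \<open>(r, w)\<close> of an integer and a reduced word stand for \<open>w \<Delta>\<^sup>r\<close>.
  The braid group acts on such pairs by left multiplication.  Acting on the trivial pair,
  a reduced word yields itself with exponent \<open>0\<close>, whereas an element of \<open>\<Delta> MB\<^sub>3\<close> yields a positive
  exponent, because generators never decrease the exponent.\<close>

section \<open>Reduced words and the action of letters on pairs\<close>

fun other :: "gen \<Rightarrow> gen" where
  "other X1 = X2"
| "other X2 = X1"

lemma other_other [simp]: "other (other g) = g"
  by (cases g) auto

lemma other_neq [simp]: "other g \<noteq> g" "g \<noteq> other g"
  by (cases g; simp)+

lemma other_eq_iff [simp]: "other a = other b \<longleftrightarrow> a = b"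
  by (metis other_other)

lemma neq_iff_other: "a \<noteq> b \<longleftrightarrow> b = other a"
  by (cases a; cases b) auto

lemma map_other_other [simp]: "map other (map other w) = w" "map (other \<circ> other) w = w"
  by (induction w) auto

lemma neq_gen_iff: "a \<noteq> X1 \<longleftrightarrow> a = X2" "a \<noteq> X2 \<longleftrightarrow> a = X1"
  by (cases a; simp)+

text \<open>With two letters, \<open>a \<noteq> b\<close> and \<open>b \<noteq> c\<close> force
  \<open>c = a\<close>, so exactly the two words for \<open>Delta3\<close> are forbidden as
  factors.\<close>

fun reduced :: "gen list \<Rightarrow> bool" where
  "reduced (a # b # c # w) \<longleftrightarrow> (a = b \<or> b = c) \<and> reduced (b # c # w)"
| "reduced _ \<longleftrightarrow> True"

lemma reduced_ConsD: "reduced (a # w) \<Longrightarrow> reduced w"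
  by (cases "a # w" rule: reduced.cases) auto

lemma reduced_map_other [simp]: "reduced (map other w) \<longleftrightarrow> reduced w"
  by (induction w rule: reduced.induct) auto

lemma reduced_Cons_same: "reduced (a # a # w) \<longleftrightarrow> reduced (a # w)"
  by (cases w) auto

text \<open>A factor \<Delta> completed by \<open>g\<close> moves right past \<open>w\<close>,
  exchanging the letters of \<open>w\<close>. In the last clause the inverse of \<open>g\<close> is
  rewritten as \<open>other g\<close>, \<open>g\<close>, \<Delta> to the power -1, and this power
  moves past \<open>w\<close> likewise.\<close>

fun act :: "letter \<Rightarrow> int \<times> gen list \<Rightarrow> int \<times> gen list" where
  "act (g, True) (r, a # b # w) =
    (if a \<noteq> g \<and> b = g then (r + 1, map other w) else (r, g # a # b # w))"
| "act (g, True) (r, w) = (r, g # w)"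
| "act (g, False) (r, w) =
    (if w \<noteq> [] \<and> hd w = g then (r, tl w) else (r - 1, other g # g # map other w))"

lemma act_same [simp]: "act (g, True) (r, g # w) = (r, g # g # w)"
  by (cases w) auto

text \<open>In the clause lowering the exponent, a nonempty \<open>w\<close> starts with
  \<open>other g\<close>, so \<open>map other w\<close> starts with \<open>g\<close> and the two
  letters put in front create no forbidden factor.\<close>

lemma act_reduced:
  assumes "reduced (snd p)"
  shows "reduced (snd (act l p))"
  using assms
proof (cases "(l, p)" rule: act.cases)
  case (1 g r a b w)
  with assms show ?thesis
    by (cases a; cases b; cases g) (auto dest: reduced_ConsD simp: reduced_Cons_same)
next
  case (3 g r w)
  show ?thesis
  proof (cases w)
    case (Cons a v)
    with assms 3 reduced_map_other[of w] show ?thesis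
      by (cases a; cases g)
         (auto dest: reduced_ConsD simp: reduced_Cons_same simp del: reduced_map_other)
  qed (use 3 in simp)
qed auto

text \<open>Reducedness matters when \<Delta> is split off \<open>g # other g # g # w\<close>: there
  \<open>w\<close> is empty or starts with \<open>g\<close>, so \<open>map other w\<close> does not
  start with \<open>g\<close> and the inverse letter restores the lost letters instead of
  cancelling.\<close>

lemma act_cancel:
  assumes "reduced (snd p)"
  shows "act (g, b) (act (g, \<not> b) p) = p"
proof -
  obtain r w where p: "p = (r, w)" by (cases p)
  with assms show ?thesis
    by (cases b; cases g; cases w rule: reduced.cases)
       (auto simp: neq_gen_iff)
qed

text \<open>The result is independent of \<open>g\<close>, which yields the braid relation for the
  action.\<close>

lemma act_Delta:
  assumes "reduced (snd p)"
  shows "act (g, True) (act (other g, True) (act (g, True) p)) = (fst p + 1, map other (snd p))"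
proof -
  obtain r w where p: "p = (r, w)" by (cases p)
  with assms show ?thesis
    by (cases g; cases w rule: reduced.cases) (auto simp: neq_gen_iff)
qed

section \<open>The induced normal form of braids\<close>

lemma foldr_act_reduced: "reduced (snd p) \<Longrightarrow> reduced (snd (foldr act u p))"
  by (induction u) (auto intro: act_reduced)

lemma foldr_act_cong:
  "braid_eq u v \<Longrightarrow> reduced (snd p) \<Longrightarrow> foldr act u p = foldr act v p"
proof (induction arbitrary: p rule: braid_eq.induct)
  case (cancel g b)
  then show ?case using act_cancel by simp
next
  case braid
  then show ?case using act_Delta[of p X1] act_Delta[of p X2] by simp
qed (auto simp: foldr_act_reduced)

lift_definition normal_form :: "braid3 \<Rightarrow> int \<times> gen list" is "\<lambda>u. foldr act u (0, [])"
  by (rule foldr_act_cong) auto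

lemma normal_form_1: "normal_form 1 = (0, [])"
  by transfer simp

lemma normal_form_gen_mult: "normal_form (braid_gen g * b) = act (g, True) (normal_form b)"
  by transfer simp

lemma normal_form_reduced: "reduced (snd (normal_form b))"
  by transfer (simp add: foldr_act_reduced)

lemma normal_form_Delta_mult:
  "normal_form (Delta3 * b) = (fst (normal_form b) + 1, map other (snd (normal_form b)))"
  using act_Delta[OF normal_form_reduced, of X1]
  by (simp add: Delta3_def mult.assoc normal_form_gen_mult)

lemma fst_act_gen: "fst p \<le> fst (act (g, True) p)"
  by (cases "((g, True), p)" rule: act.cases) auto

lemma normal_form_MB3: "b \<in> MB3 \<Longrightarrow> 0 \<le> fst (normal_form b)"
  by (induction rule: MB3.induct)
     (auto simp: normal_form_1 normal_form_gen_mult intro: order.trans[OF _ fst_act_gen])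

lemma normal_form_reduced_word:
  "reduced w \<Longrightarrow> normal_form (prod_list (map braid_gen w)) = (0, w)"
proof (induction w)
  case (Cons g w)
  then have "normal_form (prod_list (map braid_gen w)) = (0, w)"
    by (blast dest: reduced_ConsD)
  with Cons.prems show ?case
    by (cases "g # w" rule: reduced.cases) (auto simp: normal_form_1 normal_form_gen_mult simp del: mult_1_right)
qed (simp add: normal_form_1)

lemma reduced_word_not_Delta_multiple:
  assumes "reduced w" "b \<in> MB3"
  shows "prod_list (map braid_gen w) \<noteq> Delta3 * b"
  using normal_form_reduced_word[OF assms(1)] normal_form_MB3[OF assms(2)]
  by (auto simp: normal_form_Delta_mult)

section \<open>Reducedness of products of syllables\<close>

lemma reduced_replicate_append:
  assumes "reduced w" "\<And>a b v. w = a # b # v \<Longrightarrow> a = b"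
  shows "reduced (replicate n g @ w)"
proof (induction n)
  case (Suc n)
  show ?case
  proof (cases n)
    case 0
    with assms show ?thesis by (cases w rule: reduced.cases) auto
  qed (use Suc in \<open>auto simp: reduced_Cons_same\<close>)
qed (use assms in simp)

lemma reduced_syllables:
  fixes s :: "nat \<Rightarrow> nat"
  assumes "k \<le> h + 1" "\<And>j. k < j \<Longrightarrow> j < h \<Longrightarrow> 2 \<le> s j"
  shows "reduced (concat (map (\<lambda>j. replicate (s j) (i j)) [k..<h + 1]))"
  using assms
proof (induction rule: inc_induct)
  case (step k)
  let ?w = "\<lambda>k. concat (map (\<lambda>j. replicate (s j) (i j)) [k..<h + 1])"
  \<comment> \<open>The remaining word is empty, a single power with arbitrary exponent, or starts
    with an inner syllable of exponent at least 2.\<close>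
  have "a = b" if eq: "?w (Suc k) = a # b # v" for a b v
  proof -
    consider "k = h" | "Suc k = h" | "Suc k < h" using step.hyps by linarith
    then show ?thesis
    proof cases
      case 2
      with eq have "replicate (s h) (i h) = a # b # v" by simp
      then show ?thesis by (metis in_set_replicate list.set_intros)
    next
      case 3
      then have "2 \<le> s (Suc k)" by (intro step.prems) auto
      then obtain m where "s (Suc k) = Suc (Suc m)" by (metis add_2_eq_Suc le_Suc_ex)
      with 3 eq show ?thesis by (auto simp: upt_conv_Cons simp del: upt_Suc)
    qed (use eq in simp)
  qed
  moreover have "reduced (?w (Suc k))" using step by auto
  ultimately show ?case
    using reduced_replicate_append[of "?w (Suc k)" "s k" "i k"] step.hyps
    by (simp add: upt_conv_Cons del: upt_Suc)
qed simp

section \<open>Extracting \<Delta> from positive words\<close>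

lemma prod_list_syllables:
  "prod_list (map (\<lambda>j. braid_gen (i j) ^ s j) js) =
    prod_list (map braid_gen (concat (map (\<lambda>j. replicate (s j) (i j)) js)))"
  by (induction js) simp_all

lemma MB3_mult: "a \<in> MB3 \<Longrightarrow> b \<in> MB3 \<Longrightarrow> a * b \<in> MB3"
  by (induction rule: MB3.induct) (auto simp: mult.assoc intro: MB3.intros)

lemma MB3_gen_power: "braid_gen g ^ n \<in> MB3"
  by (induction n) (auto intro: MB3.intros)

lemma MB3_prod_list: "(\<And>b. b \<in> set bs \<Longrightarrow> b \<in> MB3) \<Longrightarrow> prod_list bs \<in> MB3"
  by (induction bs) (auto intro: MB3.one MB3_mult)

lemma Delta3_eq: "braid_gen g * (braid_gen (other g) * braid_gen g) = Delta3"
  using braid_relation by (cases g) (simp_all add: Delta3_def mult.assoc)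

text \<open>Both sides bracket the alternating word \<open>g\<close>, \<open>other g\<close>,
  \<open>g\<close>, \<open>other g\<close>.\<close>

lemma gen_mult_Delta3: "braid_gen g * Delta3 = Delta3 * braid_gen (other g)"
  using Delta3_eq[of g] Delta3_eq[of "other g"] by (metis mult.assoc other_other)

lemma MB3_mult_Delta3: "a \<in> MB3 \<Longrightarrow> \<exists>a'\<in>MB3. a * Delta3 = Delta3 * a'"
proof (induction rule: MB3.induct)
  case (gen_mult w g)
  then obtain a' where "a' \<in> MB3" "w * Delta3 = Delta3 * a'" by blast
  then show ?case
    by (metis MB3.gen_mult gen_mult_Delta3 mult.assoc)
qed (use MB3.one in force)

lemma Delta3_factor:
  assumes "a \<in> MB3" "b \<in> MB3"
  shows "a * Delta3 * b \<in> (\<lambda>w. Delta3 * w) ` MB3"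
proof -
  obtain a' where "a' \<in> MB3" "a * Delta3 = Delta3 * a'"
    using MB3_mult_Delta3[OF assms(1)] by blast
  then show ?thesis using assms(2) by (auto simp: mult.assoc intro: MB3_mult)
qed

lemma syllables_Delta_multiple:
  fixes s :: "nat \<Rightarrow> nat"
  assumes "1 < j" "j < h" "s j = 1" "s (j - 1) > 0" "s (j + 1) > 0"
    and "i (j - 1) \<noteq> i j" "i j \<noteq> i (j + 1)"
  shows "prod_list (map (\<lambda>j. braid_gen (i j) ^ s j) [1..<h + 1]) \<in> (\<lambda>w. Delta3 * w) ` MB3"
proof -
  let ?P = "\<lambda>js. prod_list (map (\<lambda>j. braid_gen (i j) ^ s j) js)"
  let ?g = "i (j - 1)"
  have P: "?P js \<in> MB3" for js by (auto intro!: MB3_prod_list MB3_gen_power)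
  obtain m n where mn: "s (j - 1) = Suc m" "s (j + 1) = Suc n"
    using assms(4,5) gr0_implies_Suc by metis
  have gens: "i j = other ?g" "i (j + 1) = ?g"
    using assms(6,7) by (auto simp: neq_iff_other)
  have "[1..<h + 1] = [1..<j - 1] @ [j - 1, j, j + 1] @ [j + 2..<h + 1]"
  proof -
    have "[1..<h + 1] = [1..<j - 1] @ [j - 1..<h + 1]"
      using assms(1,2) upt_add_eq_append[of 1 "j - 1" "h + 1 - (j - 1)"] by simp
    also have "[j - 1..<h + 1] = [j - 1, j, j + 1] @ [j + 2..<h + 1]"
      using assms(1,2) by (simp add: upt_conv_Cons del: upt_Suc)
    finally show ?thesis .
  qed
  then have "?P [1..<h + 1] = ?P [1..<j - 1] * (braid_gen ?g ^ Suc m * (braid_gen (other ?g) *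
      (braid_gen ?g ^ Suc n * ?P [j + 2..<h + 1])))"
    using mn gens assms(3) by (simp add: mult.assoc del: upt_Suc power_Suc)
  also have "\<dots> = ?P [1..<j - 1] * braid_gen ?g ^ m * (braid_gen ?g * (braid_gen (other ?g) *
      braid_gen ?g)) * (braid_gen ?g ^ n * ?P [j + 2..<h + 1])"
    \<comment> \<open>The left neighbour gives up its last letter, the right neighbour its first;
      around syllable \<open>j\<close> they form \<Delta>.\<close>
    by (subst power_Suc2) (simp add: mult.assoc)
  finally show ?thesis
    unfolding Delta3_eq by (simp only:) (intro Delta3_factor MB3_mult P MB3_gen_power)
qed

theorem theorem1:
  fixes r :: int and h :: nat and i :: "nat \<Rightarrow> gen" and s :: "nat \<Rightarrow> nat" and W :: braid3
  assumes "\<And>j. 1 \<le> j \<Longrightarrow> j < h \<Longrightarrow> i j \<noteq> i (j + 1)"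
    and "\<And>j. 1 \<le> j \<Longrightarrow> j \<le> h \<Longrightarrow> s j > 0"
    and "W = prod_list (map (\<lambda>j. braid_gen (i j) ^ s j) [1..<h + 1])"
  shows "garside_normal_form (Delta3 powi r * W) r W \<longleftrightarrow>
    h \<le> 2 \<or> (h \<ge> 3 \<and> (\<forall>j. 1 < j \<and> j < h \<longrightarrow> s j \<ge> 2))"
proof -
  have "W \<in> MB3"
    unfolding assms(3) by (rule MB3_prod_list) (auto simp del: upt_Suc intro: MB3_gen_power)
  then have "garside_normal_form (Delta3 powi r * W) r W \<longleftrightarrow> W \<notin> (\<lambda>w. Delta3 * w) ` MB3"
    by (simp add: garside_normal_form_def MB3_plus_def)
  \<comment> \<open>For \<open>h \<le> 2\<close> this condition is vacuous, so it covers both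
    alternatives.\<close>
  also have "\<dots> \<longleftrightarrow> (\<forall>j. 1 < j \<and> j < h \<longrightarrow> s j \<ge> 2)"
  proof (intro iffI allI impI)
    fix j
    assume W: "W \<notin> (\<lambda>w. Delta3 * w) ` MB3" and j: "1 < j \<and> j < h"
    show "s j \<ge> 2"
    proof (rule ccontr)
      assume "\<not> s j \<ge> 2"
      then have "s j = 1" using assms(2)[of j] j by linarith
      moreover have "i (j - 1) \<noteq> i j" "i j \<noteq> i (j + 1)"
        using assms(1)[of "j - 1"] assms(1)[of j] j by (simp_all add: le_diff_conv2 less_imp_diff_less)
      ultimately have "W \<in> (\<lambda>w. Delta3 * w) ` MB3"
        unfolding assms(3) using j by (intro syllables_Delta_multiple[of j] assms(2)) auto
      with W show False by simp
    qed
  next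
    assume "\<forall>j. 1 < j \<and> j < h \<longrightarrow> s j \<ge> 2"
    then have "reduced (concat (map (\<lambda>j. replicate (s j) (i j)) [1..<h + 1]))"
      by (intro reduced_syllables) auto
    then show "W \<notin> (\<lambda>w. Delta3 * w) ` MB3"
      unfolding assms(3) prod_list_syllables using reduced_word_not_Delta_multiple by blast
  qed
  finally show ?thesis by auto
qed

end
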